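(* Let $\mathcal A$ be a finite alphabet, let $(X,\sigma)$, $X\subset\mathcal A^{\mathbb Z}$, be a two-sided subshift such that $X$ is a Cantor set, let $p:X\to\mathbb N=\{1,2,3,\dots\}$ be continuous, and suppose that the speedup $S:X\to X$, $S(x)=\sigma^{p(x)}(x)$, is a homeomorphism of $X$ and is topologically transitive. Then $(X,\sigma)$ is linearly recurrent if and only if the speedup $(X,S)$, viewed as a subshift over the alphabet $\mathcal B=\{x_0x_1\dots x_{p(x)-1}:x\in X\}$, is linearly recurrent.
   Context: A two-sided subshift $(X,\sigma)$ over a finite alphabet $\mathcal A$ is a closed non-empty set $X\subset\mathcal A^{\mathbb Z}$ (product topology) with $\sigma(X)=X$, where $\sigma(x)_i=x_{i+1}$ is the left-shift. Its language $\mathcal L(X)$ is the set of (non-empty) finite words appearing as subwords of some $x\in X$; $|w|$ is the length of $w$. Linear recurrence: $(X,\sigma)$ is linearly recurrent if there is $L\in\mathbb N$ such that for every $w\in\mathcal L(X)$, every $x\in X$ and every $i\in\mathbb Z$ there is $k\in\{0,1,\dots,L|w|\}$ with $x_{i+k+1}\dots x_{i+k+|w|}=w$. Transitive: there is a point of $X$ whose $S$-orbit is dense in $X$. The speedup as a subshift: $p$ is continuous on a compact space, hence bounded, so $\mathcal B=\{x_0x_1\dots x_{p(x)-1}:x\in X\}$ is a finite set of words, whose elements are used as letters. To $x\in X$ associate $\pi(x)=(b_i)_{i\in\mathbb Z}\in\mathcal B^{\mathbb Z}$, where $b_i=y_0y_1\dots y_{p(y)-1}$ for $y=S^i(x)$.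 Then $S$ corresponds to the left-shift on $\pi(X)$, and "$(X,S)$ is linearly recurrent" means that the subshift $\pi(X)\subset\mathcal B^{\mathbb Z}$ with the left-shift is linearly recurrent. *)

theory Defs
  imports "HOL-Analysis.Analysis"
begin

definition full_shift_topology :: "'a set \<Rightarrow> (int \<Rightarrow> 'a) topology" where
  "full_shift_topology A = product_topology (\<lambda>_. discrete_topology A) UNIV"

definition shift :: "(int \<Rightarrow> 'a) \<Rightarrow> int \<Rightarrow> 'a" where
  "shift x = (\<lambda>i. x (i + 1))"

(* closedin includes the inclusion X \<subseteq> topspace (full_shift_topology A) = (\<Pi>\<^sub>E i\<in>UNIV. A). *)
definition subshift :: "'a set \<Rightarrow> (int \<Rightarrow> 'a) set \<Rightarrow> bool" where
  "subshift A X \<longleftrightarrow>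
     finite A \<and> closedin (full_shift_topology A) X \<and> X \<noteq> {} \<and> shift ` X = X"

abbreviation subshift_topology :: "'a set \<Rightarrow> (int \<Rightarrow> 'a) set \<Rightarrow> (int \<Rightarrow> 'a) topology" where
  "subshift_topology A X \<equiv> subtopology (full_shift_topology A) X"

(* The model Cantor set is the product of countably many two-point discrete spaces. *)
definition cantor_space :: "'a topology \<Rightarrow> bool" where
  "cantor_space T \<longleftrightarrow>
     T homeomorphic_space product_topology (\<lambda>_::nat. discrete_topology (UNIV :: bool set)) UNIV"

(* The word x_i x_(i+1) ... x_(i+n-1). *)
definition subword :: "(int \<Rightarrow> 'a) \<Rightarrow> int \<Rightarrow> nat \<Rightarrow> 'a list" where
  "subword x i n = map (\<lambda>j. x (i + int j)) [0..<n]"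

definition language :: "(int \<Rightarrow> 'a) set \<Rightarrow> 'a list set" where
  "language X = {subword x i n | x i n. x \<in> X \<and> n \<ge> 1}"

definition linearly_recurrent :: "(int \<Rightarrow> 'a) set \<Rightarrow> bool" where
  "linearly_recurrent X \<longleftrightarrow>
     (\<exists>L::nat. \<forall>w\<in>language X. \<forall>x\<in>X. \<forall>i::int.
        \<exists>k\<in>{0..L * length w}. subword x (i + int k + 1) (length w) = w)"

definition speedup :: "((int \<Rightarrow> 'a) \<Rightarrow> nat) \<Rightarrow> (int \<Rightarrow> 'a) \<Rightarrow> int \<Rightarrow> 'a" where
  "speedup p x = (shift ^^ p x) x"

(* The n-th iterate, n an integer, of a bijection S of X; the inverse is that of S restricted
   to X, since S need not be injective on the whole type. *)
definition int_iterate :: "'b set \<Rightarrow> ('b \<Rightarrow> 'b) \<Rightarrow> int \<Rightarrow> 'b \<Rightarrow> 'b" where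
  "int_iterate X S n =
     (if n \<ge> 0 then S ^^ nat n else inv_into X S ^^ nat (- n))"

(* Transitivity of a homeomorphism S of the space T, by means of two-sided orbits. *)
definition transitive_homeo :: "'b topology \<Rightarrow> ('b \<Rightarrow> 'b) \<Rightarrow> bool" where
  "transitive_homeo T S \<longleftrightarrow>
     (\<exists>x\<in>topspace T. T closure_of (range (\<lambda>n. int_iterate (topspace T) S n x)) = topspace T)"

definition speedup_letter :: "((int \<Rightarrow> 'a) \<Rightarrow> nat) \<Rightarrow> (int \<Rightarrow> 'a) \<Rightarrow> 'a list" where
  "speedup_letter p x = subword x 0 (p x)"

definition speedup_alphabet :: "(int \<Rightarrow> 'a) set \<Rightarrow> ((int \<Rightarrow> 'a) \<Rightarrow> nat) \<Rightarrow> 'a list set" where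
  "speedup_alphabet X p = speedup_letter p ` X"

definition speedup_coding ::
    "(int \<Rightarrow> 'a) set \<Rightarrow> ((int \<Rightarrow> 'a) \<Rightarrow> nat) \<Rightarrow> (int \<Rightarrow> 'a) \<Rightarrow> int \<Rightarrow> 'a list" where
  "speedup_coding X p x = (\<lambda>i. speedup_letter p (int_iterate X (speedup p) i x))"

definition speedup_subshift ::
    "(int \<Rightarrow> 'a) set \<Rightarrow> ((int \<Rightarrow> 'a) \<Rightarrow> nat) \<Rightarrow> (int \<Rightarrow> 'a list) set" where
  "speedup_subshift X p = speedup_coding X p ` X"

lemma topspace_subshift_topology:
  assumes "subshift A X"
  shows "topspace (subshift_topology A X) = X"
  using assms closedin_subset by (fastforce simp: subshift_def)

lemma compact_space_subshift:
  assumes "subshift A X"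
  shows "compact_space (subshift_topology A X)"
proof -
  have "compact_space (full_shift_topology A)"
    using assms
    by (auto simp: full_shift_topology_def compact_space_product_topology subshift_def
        compact_space_discrete_topology)
  then show ?thesis
    using assms closedin_compact_space compact_space_subtopology subshift_def by blast
qed

lemma int_iterate_in:
  assumes "bij_betw S X X" "x \<in> X"
  shows "int_iterate X S n x \<in> X"
proof -
  have 1: "(S ^^ k) x \<in> X" for k
    by (induction k) (use assms bij_betwE in \<open>auto\<close>)
  have 2: "(inv_into X S ^^ k) x \<in> X" for k
    by (induction k) (use assms bij_betwE[OF bij_betw_inv_into[OF assms(1)]] in \<open>auto\<close>)
  show ?thesis using 1 2 by (simp add: int_iterate_def)
qed

lemma int_iterate_step:
  assumes "bij_betw S X X" "x \<in> X"
  shows "int_iterate X S n (S x) = int_iterate X S (n + 1) x"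
proof (cases "n \<ge> 0")
  case True
  then have "nat (n + 1) = Suc (nat n)" by simp
  with True show ?thesis by (simp add: int_iterate_def funpow_swap1)
next
  case False
  then obtain k where k: "n = - int (Suc k)"
    by (metis int_cases not_less of_nat_0_le_iff)
  have "int_iterate X S n (S x) = (inv_into X S ^^ k) (inv_into X S (S x))"
    using k by (simp add: int_iterate_def nat_add_distrib funpow_swap1)
  also have "\<dots> = (inv_into X S ^^ k) x"
    using assms by (simp add: bij_betw_inv_into_left)
  also have "\<dots> = int_iterate X S (n + 1) x"
    using k by (cases k) (auto simp: int_iterate_def nat_add_distrib)
  finally show ?thesis .
qed

lemma continuous_map_int_iterate:
  assumes "homeomorphic_map T T S"
  shows "continuous_map T T (int_iterate (topspace T) S n)"
proof -
  have S: "continuous_map T T S"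
    using assms homeomorphic_imp_continuous_map by blast
  have b: "bij_betw S (topspace T) (topspace T)"
    using assms by (simp add: bij_betw_def homeomorphic_eq_everything_map)
  obtain g where g: "homeomorphic_maps T T S g"
    using assms homeomorphic_map_maps by blast
  have "inv_into (topspace T) S x = g x" if "x \<in> topspace T" for x
    using g b that unfolding homeomorphic_maps_def
    by (metis bij_betw_inv_into_left continuous_map_image_subset_topspace image_subset_iff)
  then have I: "continuous_map T T (inv_into (topspace T) S)"
    using g continuous_map_eq unfolding homeomorphic_maps_def by metis
  have pow: "continuous_map T T (f ^^ k)" if "continuous_map T T f" for f k
    by (induction k) (use that in \<open>auto simp: id_def intro: continuous_map_compose simp del: o_apply\<close>)
  show ?thesis
    using pow[OF S] pow[OF I] by (simp add: int_iterate_def)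
qed

lemma continuous_map_speedup_letter:
  assumes X: "subshift A X"
    and p: "continuous_map (subshift_topology A X) (discrete_topology {1..}) p"
  shows "continuous_map (subshift_topology A X) (discrete_topology (speedup_alphabet X p))
           (speedup_letter p)"
proof -
  let ?T = "subshift_topology A X"
  have top: "topspace ?T = X" by (rule topspace_subshift_topology[OF X])
  have coord: "continuous_map ?T (discrete_topology A) (\<lambda>x. x i)" for i
    unfolding full_shift_topology_def
    by (intro continuous_map_from_subtopology continuous_map_product_projection) auto
  have p_pos: "p x \<ge> 1" if "x \<in> X" for x
    using continuous_map_image_subset_topspace[OF p] top that by auto
  have in_A: "x i \<in> A" if "x \<in> X" for x i
    using continuous_map_image_subset_topspace[OF coord] top that by force
  have op: "openin ?T {x \<in> X. speedup_letter p x = w}" for w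
  proof (cases "w = []")
    case True
    then have "{x \<in> X. speedup_letter p x = w} = {}"
      using p_pos by (force simp: speedup_letter_def subword_def)
    then show ?thesis by (simp only: openin_empty)
  next
    case False
    have 1: "openin ?T {x \<in> X. p x \<in> {length w} \<inter> {1..}}"
      using openin_continuous_map_preimage[OF p, of "{length w} \<inter> {1..}"] unfolding top by simp
    have 2: "openin ?T {x \<in> X. x (int j) \<in> {w ! j} \<inter> A}" for j
      using openin_continuous_map_preimage[OF coord, of "{w ! j} \<inter> A"] unfolding top by simp
    have "{x \<in> X. speedup_letter p x = w} = {x \<in> X. p x \<in> {length w} \<inter> {1..}} \<inter>
        (\<Inter>j\<in>{..<length w}. {x \<in> X. x (int j) \<in> {w ! j} \<inter> A})"
    proof -
      have "speedup_letter p x = w \<longleftrightarrow> p x = length w \<and> (\<forall>j<length w. x (int j) = w ! j)" for x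
        by (auto simp: speedup_letter_def subword_def list_eq_iff_nth_eq)
      then show ?thesis using p_pos in_A by auto
    qed
    moreover have "openin ?T (\<Inter>j\<in>{..<length w}. {x \<in> X. x (int j) \<in> {w ! j} \<inter> A})"
      using False by (intro openin_INT2 2) auto
    ultimately show ?thesis using 1 by (simp only: openin_Int)
  qed
  have "openin ?T {x \<in> X. speedup_letter p x \<in> U}" for U
  proof -
    have "{x \<in> X. speedup_letter p x \<in> U} = (\<Union>w\<in>U. {x \<in> X. speedup_letter p x = w})"
      by auto
    then show ?thesis using op by auto
  qed
  then show ?thesis
    using top by (auto simp: continuous_map speedup_alphabet_def)
qed

(* The coded speedup is a genuine subshift over its (finite) alphabet. *)
lemma subshift_speedup:
  assumes X: "subshift A X"
    and p: "continuous_map (subshift_topology A X) (discrete_topology {1..}) p"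
    and S: "homeomorphic_map (subshift_topology A X) (subshift_topology A X) (speedup p)"
  shows "subshift (speedup_alphabet X p) (speedup_subshift X p)"
proof -
  let ?T = "subshift_topology A X" and ?B = "speedup_alphabet X p"
  let ?F = "full_shift_topology ?B"
  have top: "topspace ?T = X" by (rule topspace_subshift_topology[OF X])
  have b: "bij_betw (speedup p) X X"
    using S top by (simp add: homeomorphic_eq_everything_map bij_betw_def)
  have l: "continuous_map ?T (discrete_topology ?B) (speedup_letter p)"
    by (rule continuous_map_speedup_letter[OF X p])
  have comp: "compact_space ?T" by (rule compact_space_subshift[OF X])
  have "compactin (discrete_topology ?B) (speedup_letter p ` X)"
    using image_compactin[OF _ l] comp top by (metis compact_space_def)
  then have fin: "finite ?B"
    by (simp add: speedup_alphabet_def compactin_discrete_topology)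
  have "continuous_map ?T (discrete_topology ?B) (\<lambda>x. speedup_coding X p x i)" for i
    using continuous_map_compose[OF continuous_map_int_iterate[OF S] l] top
    by (simp add: speedup_coding_def o_def)
  then have "continuous_map ?T ?F (speedup_coding X p)"
    by (simp add: full_shift_topology_def continuous_map_componentwise_UNIV)
  then have "compactin ?F (speedup_subshift X p)"
    unfolding speedup_subshift_def using image_compactin comp top
    by (metis compact_space_def)
  moreover have "Hausdorff_space ?F"
    by (simp add: full_shift_topology_def Hausdorff_space_product_topology)
  ultimately have cl: "closedin ?F (speedup_subshift X p)"
    using compactin_imp_closedin by blast
  have "shift (speedup_coding X p x) = speedup_coding X p (speedup p x)" if "x \<in> X" for x
    using int_iterate_step[OF b that] by (simp add: shift_def speedup_coding_def)
  then have "shift ` speedup_subshift X p = speedup_coding X p ` (speedup p ` X)"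
    by (simp add: speedup_subshift_def image_image)
  then have "shift ` speedup_subshift X p = speedup_subshift X p"
    using b by (simp add: speedup_subshift_def bij_betw_def)
  with fin cl X show ?thesis
    by (simp add: subshift_def speedup_subshift_def)
qed

end

theory Submission
  imports Defs
begin

text \<open>
  A coded word of length n of the speedup determines n letters of X, and a word of X of length
  O(n) determines a coded word of length n; so the real content is that, for X linearly
  recurrent, every S-orbit visits the cylinder of a word of length n within time O(n).

  The shift orbit of a point splits into finitely many S-orbits, its threads. Suppose that the
  thread O of x misses the cylinder of w up to a large time T. For a longer word u, call a thread
  through u good if it is realised by O at some occurrence of u in the window [0,T] of x.
  Passing to extensions of u can only decrease the number of good threads, which is bounded
  independently of n, so among boundedly many scales there are two consecutive ones with the same
  minimal number. For a minimiser u at such a scale, goodness is preserved along a thread from one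
  occurrence of u to the next, since both lie in a word of the next scale. Hence the points whose
  thread is good at u and those whose thread is not form disjoint S-invariant open sets. The first
  is nonempty as O passes u before T; the second is nonempty because w occurs in u and the thread
  of u hitting that occurrence is not good. This contradicts transitivity.
\<close>

section \<open>Crossings of an increasing bijection of the integers\<close>

text \<open>Raising the level from \<open>k\<close> to \<open>k + 1\<close> affects only the thread
  through \<open>k\<close>: its last point below the level changes from the preimage of
  \<open>k\<close> to \<open>k\<close> itself. The bound \<open>lo + R \<le> m\<close> keeps that
  preimage at or above \<open>lo\<close>, where \<open>H\<close> is invariant.\<close>

lemma crossing_card:
  fixes f :: "int \<Rightarrow> int"
  assumes f: "bij f" "\<And>t. t < f t" "\<And>t. f t \<le> t + R"
    and H: "H \<subseteq> {lo..<hi}" "\<And>t. lo \<le> t \<Longrightarrow> f t < hi \<Longrightarrow> f t \<in> H \<longleftrightarrow> t \<in> H"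
    and m: "lo + R \<le> m" "m \<le> m'" "m' \<le> hi"
  shows "card {t \<in> H. t < m' \<and> m' \<le> f t} = card {t \<in> H. t < m \<and> m \<le> f t}"
  using m(2,3)
proof (induction m' rule: int_ge_induct)
  case base
  show ?case ..
next
  case (step k)
  have "bij_betw (\<lambda>t. if f t = k then k else t)
      {t \<in> H. t < k \<and> k \<le> f t} {t \<in> H. t < k + 1 \<and> k + 1 \<le> f t}"
    unfolding bij_betw_def
  proof (intro conjI equalityI subsetI)
    show "inj_on (\<lambda>t. if f t = k then k else t) {t \<in> H. t < k \<and> k \<le> f t}"
      by (rule inj_onI) (metis (mono_tags, lifting) bij_pointE f(1) less_irrefl mem_Collect_eq)
  next
    fix u assume "u \<in> (\<lambda>t. if f t = k then k else t) ` {t \<in> H. t < k \<and> k \<le> f t}"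
    then obtain t where t: "t \<in> H" "t < k" "k \<le> f t" "u = (if f t = k then k else t)"
      by auto
    have "lo \<le> t" using t(1) H(1) by auto
    then have "f t = k \<Longrightarrow> k \<in> H" using H(2)[of t] t(1) step.prems by auto
    then show "u \<in> {t \<in> H. t < k + 1 \<and> k + 1 \<le> f t}"
      using t f(2)[of k] by (auto split: if_splits)
  next
    fix u assume "u \<in> {t \<in> H. t < k + 1 \<and> k + 1 \<le> f t}"
    then have u: "u \<in> H" "u \<le> k" "k + 1 \<le> f u" by auto
    show "u \<in> (\<lambda>t. if f t = k then k else t) ` {t \<in> H. t < k \<and> k \<le> f t}"
    proof (cases "u = k")
      case True
      obtain t where t: "f t = k" using f(1) by (metis bij_pointE)
      have "lo \<le> t" using f(3)[of t] t m(1) step.hyps by simp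
      then have "t \<in> H" using H(2)[of t] t u True step.prems by simp
      then show ?thesis using t True f(2)[of t] by force
    next
      case False
      then show ?thesis using u by (auto intro!: image_eqI[of _ _ u])
    qed
  qed
  then show ?case using step by (simp add: bij_betw_same_card)
qed

text \<open>For bijective \<open>f\<close> this is the orbit relation; comparing forward iterates
  both ways avoids inverse iterates.\<close>

definition same_orbit :: "('b \<Rightarrow> 'b) \<Rightarrow> 'b \<Rightarrow> 'b \<Rightarrow> bool" where
  "same_orbit f s t \<longleftrightarrow> (\<exists>k. t = (f ^^ k) s \<or> s = (f ^^ k) t)"

lemma same_orbit_sym: "same_orbit f s t \<longleftrightarrow> same_orbit f t s"
  by (auto simp: same_orbit_def)

lemma same_orbit_forward:
  assumes "same_orbit f s t"
  shows "same_orbit f ((f ^^ k) s) t"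
proof -
  obtain l where "t = (f ^^ l) s \<or> s = (f ^^ l) t"
    using assms by (auto simp: same_orbit_def)
  then consider "t = (f ^^ l) s" "l \<le> k" | "t = (f ^^ l) s" "k \<le> l" | "s = (f ^^ l) t"
    by linarith
  then show ?thesis
  proof cases
    case 1
    then have "(f ^^ k) s = (f ^^ (k - l)) t"
      by (metis funpow_add le_add_diff_inverse2 o_apply)
    then show ?thesis by (auto simp: same_orbit_def)
  next
    case 2
    then have "t = (f ^^ (l - k)) ((f ^^ k) s)"
      by (metis funpow_add le_add_diff_inverse2 o_apply)
    then show ?thesis by (auto simp: same_orbit_def)
  next
    case 3
    then have "(f ^^ k) s = (f ^^ (k + l)) t"
      by (simp add: funpow_add)
    then show ?thesis by (auto simp: same_orbit_def)
  qed
qed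

lemma funpow_ge:
  fixes f :: "int \<Rightarrow> int"
  assumes "\<And>t. t < f t"
  shows "t + int k \<le> (f ^^ k) t"
proof (induction k)
  case (Suc k)
  then show ?case using assms[of "(f ^^ k) t"] by simp
qed simp

text \<open>Each step gains at least 1, so the iterates reach \<open>m\<close>; the crossing is the
  predecessor of the first iterate that does.\<close>

lemma crossing_exists:
  fixes f :: "int \<Rightarrow> int"
  assumes "\<And>t. t < f t" "s < m"
  obtains k where "(f ^^ k) s < m" "m \<le> f ((f ^^ k) s)"
proof -
  let ?k = "LEAST k. m \<le> (f ^^ k) s"
  have "m \<le> (f ^^ nat (m - s)) s"
    using funpow_ge[of f s "nat (m - s)"] assms by simp
  then have 1: "m \<le> (f ^^ ?k) s" by (rule LeastI)
  then obtain k where k: "?k = Suc k"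
    using assms(2) by (cases ?k) auto
  then have "\<not> m \<le> (f ^^ k) s" using not_less_Least[of k "\<lambda>k. m \<le> (f ^^ k) s"] by simp
  then show ?thesis using 1 k that[of k] by simp
qed

text \<open>Stepping back from \<open>q\<close> through preimages strictly descends, hence
  eventually falls below \<open>m\<close>.\<close>

lemma crossing_exists_backward:
  fixes f :: "int \<Rightarrow> int"
  assumes "bij f" "\<And>t. t < f t" "m \<le> q"
  obtains k s where "s < m" "m \<le> f s" "q = (f ^^ k) s"
proof -
  have "\<exists>k s. s < m \<and> m \<le> f s \<and> q = (f ^^ k) s"
    using assms(3)
  proof (induction "nat (q - m)" arbitrary: q rule: less_induct)
    case less
    obtain r where r: "f r = q" using assms(1) by (metis bij_pointE)
    show ?case
    proof (cases "r < m")
      case True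
      then show ?thesis using r less.prems by (intro exI[of _ 1] exI[of _ r]) auto
    next
      case False
      then obtain k s where "s < m" "m \<le> f s" "r = (f ^^ k) s"
        using less.hyps[of r] assms(2)[of r] r by auto
      then show ?thesis using r by (intro exI[of _ "Suc k"] exI[of _ s]) auto
    qed
  qed
  then show ?thesis using that by blast
qed

text \<open>Since \<open>f\<close> moves points up, the orbit segment between \<open>s\<close> and
  \<open>t\<close> stays inside the window, and membership propagates along it step by step.\<close>

lemma same_orbit_mem_iff:
  fixes f :: "int \<Rightarrow> int"
  assumes f: "\<And>t. t < f t"
    and H: "\<And>t. lo \<le> t \<Longrightarrow> f t < hi \<Longrightarrow> f t \<in> H \<longleftrightarrow> t \<in> H"
    and st: "same_orbit f s t" "s \<in> {lo..<hi}" "t \<in> {lo..<hi}"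
  shows "s \<in> H \<longleftrightarrow> t \<in> H"
proof -
  have *: "(f ^^ k) s \<in> H \<longleftrightarrow> s \<in> H" if "lo \<le> s" "(f ^^ k) s < hi" for k s
    using that(2)
  proof (induction k)
    case (Suc k)
    have "lo \<le> (f ^^ k) s" using funpow_ge[OF f, of s k] that(1) by simp
    then show ?case using H[of "(f ^^ k) s"] Suc f[of "(f ^^ k) s"] by simp
  qed simp
  show ?thesis using st * unfolding same_orbit_def by (metis atLeastLessThan_iff)
qed

section \<open>Integer shifts and occurrences\<close>

definition shiftz :: "int \<Rightarrow> (int \<Rightarrow> 'a) \<Rightarrow> int \<Rightarrow> 'a" where
  "shiftz s x = (\<lambda>i. x (i + s))"

lemma shiftz_0 [simp]: "shiftz 0 x = x"
  by (simp add: shiftz_def)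

lemma shiftz_shiftz [simp]: "shiftz s (shiftz t x) = shiftz (s + t) x"
  by (simp add: shiftz_def algebra_simps)

lemma funpow_shift: "(shift ^^ n) x = shiftz (int n) x"
  by (induction n) (auto simp: shift_def shiftz_def algebra_simps)

lemma speedup_eq_shiftz: "speedup p x = shiftz (int (p x)) x"
  by (simp add: speedup_def funpow_shift)

lemma shiftz_mem:
  assumes "shift ` X = X" "x \<in> X"
  shows "shiftz s x \<in> X"
proof -
  have nat: "shiftz (int n) x \<in> X" if "x \<in> X" for n x
    unfolding funpow_shift[symmetric] by (induction n) (use assms(1) that in auto)
  \<comment> \<open>For negative shifts: surjectivity of \<open>shift\<close> on \<open>X\<close>
    yields a preimage in \<open>X\<close>, which must be the backward shift of
    \<open>x\<close>.\<close>
  have "\<exists>y\<in>X. shiftz (int n) y = x" for n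
  proof (induction n)
    case (Suc n)
    then obtain y where y: "y \<in> X" "shiftz (int n) y = x" by auto
    then obtain z where "z \<in> X" "y = shift z" using assms(1) by blast
    then show ?case using y by (intro bexI[of _ z]) (auto simp: shift_def shiftz_def algebra_simps)
  qed (use assms in auto)
  then obtain y where y: "y \<in> X" "shiftz (int (nat (- s))) y = x" by blast
  show ?thesis
  proof (cases "s \<ge> 0")
    case True
    then show ?thesis using nat[OF assms(2), of "nat s"] by simp
  next
    case False
    then have "shiftz s x = y" using y(2)[symmetric] by simp
    then show ?thesis using y by simp
  qed
qed

text \<open>Words are represented by points read from position 0. The length is an integer like the
  positions; for \<open>M \<le> 0\<close> the condition is vacuous.\<close>

definition occurs :: "int \<Rightarrow> (int \<Rightarrow> 'a) \<Rightarrow> int \<Rightarrow> (int \<Rightarrow> 'a) \<Rightarrow> bool" where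
  "occurs M y s x \<longleftrightarrow> (\<forall>j\<in>{0..<M}. x (s + j) = y j)"

lemma occurs_shiftz: "occurs M y s (shiftz t x) \<longleftrightarrow> occurs M y (s + t) x"
  by (simp add: occurs_def shiftz_def algebra_simps)

lemma occurs_subword:
  assumes "occurs M z i x" "occurs N y e z" "0 \<le> e" "e + N \<le> M"
  shows "occurs N y (i + e) x"
  unfolding occurs_def
proof
  fix j assume j: "j \<in> {0..<N}"
  then have "x (i + (e + j)) = z (e + j)" using assms by (simp add: occurs_def)
  then show "x (i + e + j) = y j" using assms(2) j by (simp add: occurs_def add.assoc)
qed

lemma subword_eq_iff: "subword x i n = subword y k n \<longleftrightarrow> (\<forall>j<n. x (i + int j) = y (k + int j))"
  by (auto simp: subword_def)

lemma subword_eq_occurs: "subword x s n = subword y 0 n \<longleftrightarrow> occurs (int n) y s x"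
proof -
  have "{0..<int n} = int ` {..<n}"
    by (auto simp: image_iff) (metis nat_eq_iff2 nat_less_iff lessThan_iff)
  then show ?thesis unfolding subword_eq_iff occurs_def by auto
qed

text \<open>Shifting \<open>y\<close> moves any word of the language to position 0, and shifting
  \<open>x\<close> moves the start of the search to 0.\<close>

lemma linearly_recurrent_iff:
  assumes X: "\<And>x s. x \<in> X \<Longrightarrow> shiftz s x \<in> X"
  shows "linearly_recurrent X \<longleftrightarrow>
    (\<exists>L::nat. \<forall>y\<in>X. \<forall>x\<in>X. \<forall>n\<ge>1. \<exists>k\<le>L * n. occurs (int n) y (int k + 1) x)"
    (is "_ \<longleftrightarrow> (\<exists>L. ?R L)")
proof -
  have "(\<forall>w\<in>language X. \<forall>x\<in>X. \<forall>i::int.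
        \<exists>k\<in>{0..L * length w}. subword x (i + int k + 1) (length w) = w) \<longleftrightarrow> ?R L" (is "?L \<longleftrightarrow> _") for L
  proof
    assume L: ?L
    show "?R L"
    proof (intro ballI allI impI)
      fix x y and n :: nat assume xy: "x \<in> X" "y \<in> X" "1 \<le> n"
      then have "subword y 0 n \<in> language X" by (auto simp: language_def)
      from L[rule_format, OF this xy(1), of 0]
      obtain k where "k \<le> L * n" "subword x (int k + 1) n = subword y 0 n"
        by (auto simp: subword_def)
      then show "\<exists>k\<le>L * n. occurs (int n) y (int k + 1) x"
        using subword_eq_occurs by blast
    qed
  next
    assume R: "?R L"
    show ?L
    proof (intro ballI allI)
      fix w x and i :: int assume w: "w \<in> language X" and x: "x \<in> X"
      then obtain y s n where y: "w = subword y s n" "y \<in> X" "1 \<le> n"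
        by (auto simp: language_def)
      have len: "length w = n" using y by (simp add: subword_def)
      have w': "w = subword (shiftz s y) 0 n" using y by (simp add: subword_def shiftz_def algebra_simps)
      obtain k where k: "k \<le> L * n" "occurs (int n) (shiftz s y) (int k + 1) (shiftz i x)"
        using R X x y by blast
      then have "subword x (i + int k + 1) n = w"
        unfolding w' subword_eq_occurs by (simp add: occurs_shiftz algebra_simps)
      then show "\<exists>k\<in>{0..L * length w}. subword x (i + int k + 1) (length w) = w"
        using k len by auto
    qed
  qed
  then show ?thesis by (simp add: linearly_recurrent_def)
qed

section \<open>Crossing sets of a speedup\<close>

text \<open>The data that compactness supplies: a single \<open>R\<close> bounds the jumps and is
  the radius of the window that determines a jump.\<close>

locale bounded_speedup =
  fixes X :: "(int \<Rightarrow> 'a) set" and p :: "(int \<Rightarrow> 'a) \<Rightarrow> nat" and R :: int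
  assumes shift_image: "shift ` X = X"
    and p_pos: "x \<in> X \<Longrightarrow> 0 < p x"
    and p_le: "x \<in> X \<Longrightarrow> int (p x) \<le> R"
    and p_local: "x \<in> X \<Longrightarrow> y \<in> X \<Longrightarrow> (\<And>j. j \<in> {-R..R} \<Longrightarrow> x j = y j) \<Longrightarrow> p x = p y"
    and bij_speedup: "bij_betw (speedup p) X X"
begin

lemma shiftz_X: "x \<in> X \<Longrightarrow> shiftz s x \<in> X"
  by (rule shiftz_mem[OF shift_image])

text \<open>The speedup acting on the positions of a fixed \<open>x\<close>; the orbits of
  \<open>adv x\<close> on the integers are the threads.\<close>

definition adv :: "(int \<Rightarrow> 'a) \<Rightarrow> int \<Rightarrow> int" where
  "adv x t = t + int (p (shiftz t x))"

lemma adv_gt: "x \<in> X \<Longrightarrow> t < adv x t"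
  using p_pos[OF shiftz_X] by (simp add: adv_def)

lemma adv_le: "x \<in> X \<Longrightarrow> adv x t \<le> t + R"
  using p_le[OF shiftz_X] by (simp add: adv_def)

lemma R_pos: "x \<in> X \<Longrightarrow> 0 < R"
  using p_le[of x] p_pos[of x] by linarith

lemma speedup_shiftz: "speedup p (shiftz t x) = shiftz (adv x t) x"
  by (simp add: speedup_eq_shiftz adv_def add.commute)

lemma funpow_speedup: "(speedup p ^^ k) x = shiftz ((adv x ^^ k) 0) x"
  by (induction k) (auto simp: speedup_shiftz)

lemma bij_adv:
  assumes x: "x \<in> X"
  shows "bij (adv x)"
proof (rule bijI)
  show "inj (adv x)"
  proof (rule injI)
    fix s t assume st: "adv x s = adv x t"
    then have "speedup p (shiftz s x) = speedup p (shiftz t x)"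
      by (simp add: speedup_shiftz)
    then have "shiftz s x = shiftz t x"
      using bij_betw_imp_inj_on[OF bij_speedup] shiftz_X[OF x] by (auto dest: inj_onD)
    \<comment> \<open>Equal points have equal jumps, so \<open>s = t\<close> follows even when
      \<open>x\<close> is periodic.\<close>
    then show "s = t" using st by (simp add: adv_def)
  qed
next
  show "surj (adv x)"
  proof (rule surjI)
    fix t
    \<comment> \<open>The preimage of a shift of \<open>x\<close> is again a shift of
      \<open>x\<close>, namely backward by its own jump.\<close>
    let ?y = "inv_into X (speedup p) (shiftz t x)"
    have "speedup p ?y = shiftz t x"
      using bij_speedup shiftz_X[OF x] by (simp add: bij_betw_inv_into_right)
    then have "shiftz (- int (p ?y)) (shiftz (int (p ?y)) ?y) = shiftz (t - int (p ?y)) x"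
      by (simp add: speedup_eq_shiftz)
    then have "?y = shiftz (t - int (p ?y)) x" by simp
    then show "adv x (t - int (p ?y)) = t" by (simp add: adv_def)
  qed
qed

lemma adv_shiftz: "adv (shiftz s x) t = adv x (s + t) - s"
  by (simp add: adv_def add.commute)

lemma funpow_adv_shiftz: "(adv (shiftz s x) ^^ k) t = (adv x ^^ k) (s + t) - s"
  by (induction k) (auto simp: adv_shiftz)

lemma same_orbit_shiftz:
  "same_orbit (adv (shiftz s x)) (t - s) (u - s) \<longleftrightarrow> same_orbit (adv x) t u"
  by (auto simp: same_orbit_def funpow_adv_shiftz)

text \<open>A jump depends only on letters within distance \<open>R\<close>, so away from the
  margins it is the same at every occurrence of a window.\<close>

lemma adv_occurs:
  assumes "x \<in> X" "y \<in> X" "occurs M y i x" "R \<le> t" "t < M - R"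
  shows "adv x (i + t) = i + adv y t"
proof -
  have "p (shiftz (i + t) x) = p (shiftz t y)"
  proof (rule p_local)
    fix j assume "j \<in> {-R..R}"
    then have "x (i + (j + t)) = y (j + t)" using assms by (simp add: occurs_def)
    then show "shiftz (i + t) x j = shiftz t y j" by (simp add: shiftz_def algebra_simps)
  qed (use assms shiftz_X in auto)
  then show ?thesis by (simp add: adv_def)
qed

text \<open>Injectivity of \<open>adv x\<close> allows a step back along the forward orbit of 0
  except at 0 itself, whose preimage is negative and so excluded by
  \<open>0 \<le> s\<close>.\<close>

lemma adv_mem_orbit_iff:
  assumes x: "x \<in> X" and "0 \<le> s"
  shows "adv x s \<in> range (\<lambda>k. (adv x ^^ k) 0) \<longleftrightarrow> s \<in> range (\<lambda>k. (adv x ^^ k) 0)"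
proof
  assume "adv x s \<in> range (\<lambda>k. (adv x ^^ k) 0)"
  then obtain k where k: "adv x s = (adv x ^^ k) 0" by auto
  then obtain l where "k = Suc l" using adv_gt[OF x, of s] assms(2) by (cases k) auto
  then have "s = (adv x ^^ l) 0" using k bij_is_inj[OF bij_adv[OF x]] by (auto dest: injD)
  then show "s \<in> range (\<lambda>k. (adv x ^^ k) 0)" by auto
next
  assume "s \<in> range (\<lambda>k. (adv x ^^ k) 0)"
  then obtain k where "s = (adv x ^^ k) 0" by auto
  then have "adv x s = (adv x ^^ Suc k) 0" by simp
  then show "adv x s \<in> range (\<lambda>k. (adv x ^^ k) 0)" by blast
qed

text \<open>The positions in the window [0,M) of y that the S-orbit of x meets at some occurrence of this
  window in x[0,T). The margins of width R make the threads inside the window depend on the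
  window only. A thread is represented by its unique point in \<open>crossing T x M y m\<close>, its last point
  before level m.\<close>

definition traces :: "int \<Rightarrow> (int \<Rightarrow> 'a) \<Rightarrow> int \<Rightarrow> (int \<Rightarrow> 'a) \<Rightarrow> int set" where
  "traces T x M y = {t. R \<le> t \<and> t < M - R \<and>
     (\<exists>i. 0 \<le> i \<and> i + M \<le> T \<and> occurs M y i x \<and> i + t \<in> range (\<lambda>k. (adv x ^^ k) 0))}"

definition crossing :: "int \<Rightarrow> (int \<Rightarrow> 'a) \<Rightarrow> int \<Rightarrow> (int \<Rightarrow> 'a) \<Rightarrow> int \<Rightarrow> int set" where
  "crossing T x M y m = {t \<in> traces T x M y. t < m \<and> m \<le> adv y t}"

text \<open>Each occurrence of the window in \<open>x\<close> copies the jump of \<open>y\<close>,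
  so the same occurrence witnesses both memberships.\<close>

lemma traces_adv_iff:
  assumes xy: "x \<in> X" "y \<in> X" and t: "R \<le> t" "adv y t < M - R"
  shows "adv y t \<in> traces T x M y \<longleftrightarrow> t \<in> traces T x M y"
proof -
  have gt: "t < adv y t" by (rule adv_gt[OF xy(2)])
  define Q where "Q = range (\<lambda>k. (adv x ^^ k) 0)"
  have "i + adv y t \<in> Q \<longleftrightarrow> i + t \<in> Q"
    if "0 \<le> i" "occurs M y i x" for i
    using adv_occurs[OF xy that(2) t(1)] adv_mem_orbit_iff[OF xy(1), of "i + t"] that gt t
      R_pos[OF xy(1)] by (simp add: Q_def)
  then show ?thesis using t gt unfolding traces_def Q_def[symmetric] by auto
qed

lemma traces_same_orbit_iff:
  assumes xy: "x \<in> X" "y \<in> X" and "same_orbit (adv y) s t" "s \<in> {R..<M - R}" "t \<in> {R..<M - R}"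
  shows "s \<in> traces T x M y \<longleftrightarrow> t \<in> traces T x M y"
  by (rule same_orbit_mem_iff[OF adv_gt[OF xy(2)] traces_adv_iff[OF xy] assms(3-5)])

text \<open>Every occurrence of the long window contains one of the subword, so extending a window
  can only lose good threads.\<close>

lemma traces_subword:
  assumes "t \<in> traces T x M' z" "occurs M y s z" "0 \<le> s" "s + M \<le> M'" "R \<le> t - s" "t - s < M - R"
  shows "t - s \<in> traces T x M y"
proof -
  obtain i where i: "0 \<le> i" "i + M' \<le> T" "occurs M' z i x" "i + t \<in> range (\<lambda>k. (adv x ^^ k) 0)"
    using assms(1) by (auto simp: traces_def)
  have "occurs M y (i + s) x" by (rule occurs_subword[OF i(3) assms(2-4)])
  then show ?thesis
    unfolding traces_def using i assms by (intro CollectI conjI exI[of _ "i + s"]) auto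
qed

lemma crossing_subset:
  assumes "y \<in> X"
  shows "crossing T x M y m \<subseteq> {m - R..<m}"
proof
  fix t assume "t \<in> crossing T x M y m"
  then show "t \<in> {m - R..<m}" using adv_le[OF assms, of t] by (auto simp: crossing_def)
qed

lemma finite_crossing: "y \<in> X \<Longrightarrow> finite (crossing T x M y m)"
  by (rule finite_subset[OF crossing_subset]) simp_all

text \<open>The bound does not depend on the window length; this is what limits the number of scales
  to be considered.\<close>

lemma card_crossing_le: "y \<in> X \<Longrightarrow> card (crossing T x M y m) \<le> nat R"
  using card_mono[OF _ crossing_subset[of y T x M m]] by simp

lemma card_crossing_eq:
  assumes xy: "x \<in> X" "y \<in> X" and m: "2 * R \<le> m" "m \<le> M - R"
  shows "card (crossing T x M y m) = card (crossing T x M y (2 * R))"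
proof -
  have "traces T x M y \<subseteq> {R..<M - R}" by (auto simp: traces_def)
  then show ?thesis
    unfolding crossing_def
    by (rule crossing_card[OF bij_adv[OF xy(2)] adv_gt[OF xy(2)] adv_le[OF xy(2)] _ traces_adv_iff[OF xy]])
      (use m in auto)
qed

text \<open>Restricting threads from a window to a subword is injective, so equality of the numbers of
  good threads makes it bijective.\<close>

lemma crossing_subword_iff:
  assumes xyz: "x \<in> X" "y \<in> X" "z \<in> X" and s: "occurs M y s z" "0 \<le> s" "s + M \<le> M'"
    and M: "3 * R \<le> M"
    and card: "card (crossing T x M y (2 * R)) \<le> card (crossing T x M' z (2 * R))"
  shows "t \<in> crossing T x M' z (s + 2 * R) \<longleftrightarrow> t - s \<in> crossing T x M y (2 * R)"
proof -
  let ?C = "crossing T x M' z (s + 2 * R)" and ?D = "crossing T x M y (2 * R)"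
  have sub: "(\<lambda>t. t - s) ` ?C \<subseteq> ?D"
  proof (rule image_subsetI)
    fix t assume t: "t \<in> ?C"
    have bd: "s + R \<le> t" "t < s + 2 * R" using crossing_subset[OF xyz(3)] t by fastforce+
    have "adv z (s + (t - s)) = s + adv y (t - s)"
      by (rule adv_occurs[OF xyz(3,2) s(1)]) (use bd M in auto)
    then show "t - s \<in> ?D"
      using t bd traces_subword[OF _ s, of t] M by (auto simp: crossing_def)
  qed
  have inj: "inj_on (\<lambda>t. t - s) ?C" by (auto simp: inj_on_def)
  \<comment> \<open>The count does not depend on the level, so it may be compared at
    \<open>2 * R\<close>.\<close>
  have "card ?C = card (crossing T x M' z (2 * R))"
    by (rule card_crossing_eq[OF xyz(1,3)]) (use s M in auto)
  then have "card ?D \<le> card ((\<lambda>t. t - s) ` ?C)" using card inj by (simp add: card_image)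
  then have "(\<lambda>t. t - s) ` ?C = ?D"
    by (rule card_seteq[OF finite_crossing[OF xyz(2)] sub])
  moreover have "t - s \<in> (\<lambda>t. t - s) ` ?C \<longleftrightarrow> t \<in> ?C" by (simp add: image_iff)
  ultimately show ?thesis by simp
qed

text \<open>Both occurrences lie in the window of length \<open>M'\<close> starting at
  \<open>s\<close>. By the inequality \<open>card\<close>, goodness at either of them agrees with
  goodness in this larger window, which is constant along threads.\<close>

lemma crossing_transport_step:
  assumes xyv: "x \<in> X" "y \<in> X" "v \<in> X" and M: "3 * R \<le> M"
    and card: "\<And>z. z \<in> X \<Longrightarrow> card (crossing T x M y (2 * R)) \<le> card (crossing T x M' z (2 * R))"
    and s: "occurs M y s v" "occurs M y s' v" "s \<le> s'" "s' - s + M \<le> M'"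
    and t: "t < s + 2 * R" "s + 2 * R \<le> adv v t"
    and t': "t' < s' + 2 * R" "s' + 2 * R \<le> adv v t'"
    and orb: "same_orbit (adv v) t t'"
  shows "t - s \<in> crossing T x M y (2 * R) \<longleftrightarrow> t' - s' \<in> crossing T x M y (2 * R)"
proof -
  let ?z = "shiftz s v"
  have z: "?z \<in> X" using xyv shiftz_X by simp
  have bd: "s + R \<le> t" "s' + R \<le> t'" using adv_le[OF xyv(3)] t t' by (smt (verit))+
  have "t - s \<in> crossing T x M y (2 * R) \<longleftrightarrow> t - s \<in> crossing T x M' ?z (2 * R)"
    using crossing_subword_iff[OF xyv(1,2) z, of M 0 M' T "t - s"] s M card[OF z]
    by (simp add: occurs_shiftz)
  also have "\<dots> \<longleftrightarrow> t - s \<in> traces T x M' ?z"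
    using t by (simp add: crossing_def adv_shiftz)
  also have "\<dots> \<longleftrightarrow> t' - s \<in> traces T x M' ?z"
    by (rule traces_same_orbit_iff[OF xyv(1) z]) (use orb bd t t' s M in \<open>auto simp: same_orbit_shiftz\<close>)
  also have "\<dots> \<longleftrightarrow> t' - s \<in> crossing T x M' ?z (s' - s + 2 * R)"
    using t' by (auto simp: crossing_def adv_shiftz)
  also have "\<dots> \<longleftrightarrow> t' - s - (s' - s) \<in> crossing T x M y (2 * R)"
    by (rule crossing_subword_iff[OF xyv(1,2) z]) (use s M card[OF z] in \<open>auto simp: occurs_shiftz\<close>)
  finally show ?thesis by simp
qed

text \<open>By \<open>rec\<close> the next occurrence always fits with the current one into a window
  of length \<open>M'\<close>, so the transport step can be iterated while the gap
  \<open>s' - s\<close> shrinks.\<close>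

lemma crossing_transport_le:
  assumes xyv: "x \<in> X" "y \<in> X" "v \<in> X" and M: "3 * R \<le> M"
    and card: "\<And>z. z \<in> X \<Longrightarrow> card (crossing T x M y (2 * R)) \<le> card (crossing T x M' z (2 * R))"
    and rec: "\<And>s. \<exists>k. 1 \<le> k \<and> k \<le> M' - M \<and> occurs M y (s + k) v"
    and s: "occurs M y s v" "occurs M y s' v" "s \<le> s'"
    and t: "t < s + 2 * R" "s + 2 * R \<le> adv v t"
    and t': "t' < s' + 2 * R" "s' + 2 * R \<le> adv v t'"
    and orb: "same_orbit (adv v) t t'"
  shows "t - s \<in> crossing T x M y (2 * R) \<longleftrightarrow> t' - s' \<in> crossing T x M y (2 * R)"
  using s t orb
proof (induction "nat (s' - s)" arbitrary: s t rule: less_induct)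
  case less
  obtain k where k: "1 \<le> k" "k \<le> M' - M" "occurs M y (s + k) v"
    using rec[of s] by blast
  show ?case
  proof (cases "s' \<le> s + k")
    case True
    then show ?thesis
      by (intro crossing_transport_step[OF xyv M card less.prems(1-3) _ less.prems(4,5) t' less.prems(6)])
        (use k in auto)
  next
    case False
    have "t < s + k + 2 * R" using less.prems k by simp
    \<comment> \<open>The point at which the same thread crosses the intermediate
      occurrence.\<close>
    then obtain l where l: "(adv v ^^ l) t < s + k + 2 * R" "s + k + 2 * R \<le> adv v ((adv v ^^ l) t)"
      using crossing_exists[of "adv v" t] adv_gt[OF xyv(3)] by metis
    have "t - s \<in> crossing T x M y (2 * R) \<longleftrightarrow> (adv v ^^ l) t - (s + k) \<in> crossing T x M y (2 * R)"
      by (rule crossing_transport_step[OF xyv M card less.prems(1) k(3) _ _ less.prems(4,5) l])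
        (use k in \<open>auto simp: same_orbit_def\<close>)
    also have "\<dots> \<longleftrightarrow> t' - s' \<in> crossing T x M y (2 * R)"
      by (rule less.hyps[OF _ k(3) s(2) _ l same_orbit_forward[OF less.prems(6)]]) (use False k in auto)
    finally show ?thesis .
  qed
qed

lemma crossing_transport:
  assumes xyv: "x \<in> X" "y \<in> X" "v \<in> X" and M: "3 * R \<le> M"
    and card: "\<And>z. z \<in> X \<Longrightarrow> card (crossing T x M y (2 * R)) \<le> card (crossing T x M' z (2 * R))"
    and rec: "\<And>s. \<exists>k. 1 \<le> k \<and> k \<le> M' - M \<and> occurs M y (s + k) v"
    and s: "occurs M y s v" "occurs M y s' v"
    and t: "t < s + 2 * R" "s + 2 * R \<le> adv v t"
    and t': "t' < s' + 2 * R" "s' + 2 * R \<le> adv v t'"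
    and orb: "same_orbit (adv v) t t'"
  shows "t - s \<in> crossing T x M y (2 * R) \<longleftrightarrow> t' - s' \<in> crossing T x M y (2 * R)"
proof (cases "s \<le> s'")
  case True
  then show ?thesis using crossing_transport_le[OF xyv M card rec s _ t t' orb] by blast
next
  case False
  then show ?thesis
    using crossing_transport_le[OF xyv M card rec s(2,1) _ t' t iffD1[OF same_orbit_sym orb]]
    by auto
qed

text \<open>The orbit of \<open>x\<close> starts at 0, below the level \<open>i + 2 * R\<close>, and
  must cross this level inside the given occurrence.\<close>

lemma crossing_nonempty:
  assumes xy: "x \<in> X" "y \<in> X" and i: "0 \<le> i" "i + M \<le> T" "occurs M y i x" and M: "3 * R \<le> M"
  shows "crossing T x M y (2 * R) \<noteq> {}"
proof -
  have "0 < i + 2 * R" using i(1) R_pos[OF xy(1)] by simp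
  then obtain k where k: "(adv x ^^ k) 0 < i + 2 * R" "i + 2 * R \<le> adv x ((adv x ^^ k) 0)"
    using crossing_exists[of "adv x" 0] adv_gt[OF xy(1)] by metis
  define t where "t = (adv x ^^ k) 0 - i"
  have t: "t < 2 * R" "2 * R \<le> adv x (i + t) - i" "R \<le> t"
    using k adv_le[OF xy(1), of "(adv x ^^ k) 0"] by (auto simp: t_def)
  have "adv x (i + t) = i + adv y t"
    by (rule adv_occurs[OF xy i(3)]) (use t M in auto)
  moreover have "i + t \<in> range (\<lambda>k. (adv x ^^ k) 0)" by (auto simp: t_def)
  ultimately have "t \<in> crossing T x M y (2 * R)"
    using t i M unfolding crossing_def traces_def by (intro CollectI conjI exI[of _ i]) auto
  then show ?thesis by blast
qed

text \<open>The thread through \<open>e + R\<close> is followed back to level \<open>2 * R\<close>.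
  If it were good, the orbit of \<open>x\<close> would, before \<open>T\<close>, meet the position
  \<open>R\<close> after the start of an occurrence of \<open>w\<close>, against
  \<open>avoid\<close>.\<close>

lemma crossing_misses_thread:
  assumes xy: "x \<in> X" "y \<in> X" and M: "3 * R \<le> M"
    and avoid: "\<And>k. 1 \<le> k \<Longrightarrow> (adv x ^^ k) 0 \<le> T \<Longrightarrow> \<not> occurs N w ((adv x ^^ k) 0 - R) x"
    and e: "occurs N w e y" "R \<le> e" "e + 2 * R < M" "e + N \<le> M"
  obtains t where "t \<notin> crossing T x M y (2 * R)" "R \<le> t" "t < 2 * R" "2 * R \<le> adv y t"
proof -
  have "2 * R \<le> e + R" using e by simp
  then obtain k t where t: "t < 2 * R" "2 * R \<le> adv y t" "e + R = (adv y ^^ k) t"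
    using crossing_exists_backward[OF bij_adv[OF xy(2)] adv_gt[OF xy(2)]] by metis
  have Rt: "R \<le> t" using adv_le[OF xy(2), of t] t by simp
  have "t \<notin> traces T x M y"
  proof
    assume "t \<in> traces T x M y"
    moreover have "same_orbit (adv y) t (e + R)" using t(3) by (auto simp: same_orbit_def)
    ultimately have "e + R \<in> traces T x M y"
      using traces_same_orbit_iff[OF xy, of t "e + R" M T] t Rt e M by simp
    then obtain i l where i: "0 \<le> i" "i + M \<le> T" "occurs M y i x" "i + (e + R) = (adv x ^^ l) 0"
      by (auto simp: traces_def)
    have "0 < R" using R_pos[OF xy(1)] .
    \<comment> \<open>Time 0, about which \<open>avoid\<close> says nothing, is excluded because the
      position reached is positive.\<close>
    then have "l \<noteq> 0" using i e by (intro notI) simp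
    moreover have "occurs N w (i + e) x"
      by (rule occurs_subword[OF i(3) e(1)]) (use \<open>0 < R\<close> e in auto)
    moreover have "i + e = (adv x ^^ l) 0 - R" using i(4) by simp
    ultimately show False using avoid[of l] i e \<open>0 < R\<close> by auto
  qed
  then show ?thesis using that[of t] t Rt by (auto simp: crossing_def)
qed

section \<open>Two-sided iterates and dense orbits of the speedup\<close>

lemma int_iterate_succ:
  assumes "x \<in> X"
  shows "int_iterate X (speedup p) (n + 1) x = speedup p (int_iterate X (speedup p) n x)"
proof (cases "n \<ge> 0")
  case True
  then have "nat (n + 1) = Suc (nat n)" by simp
  with True show ?thesis by (simp add: int_iterate_def)
next
  case False
  let ?I = "inv_into X (speedup p)"
  obtain k where k: "n = - int (Suc k)"
    using False by (metis int_cases not_less of_nat_0_le_iff)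
  have "int_iterate X (speedup p) (- int k) x \<in> X"
    by (rule int_iterate_in[OF bij_speedup assms])
  then have "(?I ^^ k) x \<in> X" by (cases "k = 0") (simp_all add: int_iterate_def)
  then have "speedup p ((?I ^^ Suc k) x) = (?I ^^ k) x"
    using bij_speedup by (simp add: bij_betw_inv_into_right)
  moreover have "int_iterate X (speedup p) n x = (?I ^^ Suc k) x"
    using k by (simp add: int_iterate_def nat_add_distrib)
  moreover have "int_iterate X (speedup p) (n + 1) x = (?I ^^ k) x"
    using k by (cases k) (simp_all add: int_iterate_def nat_add_distrib)
  ultimately show ?thesis by simp
qed

lemma int_iterate_add_nat:
  assumes "x \<in> X"
  shows "int_iterate X (speedup p) (a + int k) x = (speedup p ^^ k) (int_iterate X (speedup p) a x)"
proof (induction k)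
  case (Suc k)
  have "a + int (Suc k) = a + int k + 1" by simp
  then show ?case by (simp only: Suc int_iterate_succ[OF assms] funpow.simps o_apply)
qed simp

text \<open>Density in terms of cylinders; the start \<open>t\<close> is free so that any chosen
  position of the word can be put at the origin.\<close>

definition dense_orbit :: "(int \<Rightarrow> 'a) \<Rightarrow> bool" where
  "dense_orbit x \<longleftrightarrow> x \<in> X \<and>
     (\<forall>y\<in>X. \<forall>M t. \<exists>a. occurs M y t (int_iterate X (speedup p) a x))"

text \<open>The dense orbit visits position \<open>t\<close> of one occurrence of the window and
  position \<open>t'\<close> of another, so a single thread joins them. In this form transitivity
  rules out two disjoint nonempty invariant open sets.\<close>

lemma dense_orbit_links:
  assumes x: "dense_orbit x" and y: "y \<in> X"
  shows "\<exists>v\<in>X. \<exists>u. occurs M y (- t) v \<and> occurs M y (u - t') v \<and> same_orbit (adv v) 0 u"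
proof -
  let ?I = "\<lambda>a. int_iterate X (speedup p) a x"
  have xX: "x \<in> X" using x by (simp add: dense_orbit_def)
  have I: "?I a \<in> X" for a by (rule int_iterate_in[OF bij_speedup xX])
  obtain a b where ab: "occurs M y (- t) (?I a)" "occurs M y (- t') (?I b)"
    using x y unfolding dense_orbit_def by blast
  show ?thesis
  proof (cases "a \<le> b")
    case True
    define u where "u = (adv (?I a) ^^ nat (b - a)) 0"
    have "?I b = shiftz u (?I a)"
      using int_iterate_add_nat[OF xX, of a "nat (b - a)"] True by (simp add: funpow_speedup u_def)
    then have "occurs M y (u - t') (?I a)" using ab(2) by (simp add: occurs_shiftz)
    moreover have "same_orbit (adv (?I a)) 0 u" by (auto simp: same_orbit_def u_def)
    ultimately show ?thesis using ab I by blast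
  next
    case False
    \<comment> \<open>Here the visit at \<open>b\<close> comes first, so the displacement seen from
      \<open>?I a\<close> is \<open>- u\<close>.\<close>
    define u where "u = (adv (?I b) ^^ nat (a - b)) 0"
    have eq: "?I a = shiftz u (?I b)"
      using int_iterate_add_nat[OF xX, of b "nat (a - b)"] False by (simp add: funpow_speedup u_def)
    have "occurs M y (- u - t') (?I a)" using ab(2) unfolding eq by (simp add: occurs_shiftz)
    moreover have "same_orbit (adv (?I b)) u 0"
      unfolding same_orbit_sym[of _ u] by (auto simp: same_orbit_def u_def)
    then have "same_orbit (adv (?I a)) 0 (- u)"
      unfolding eq using same_orbit_shiftz[of u "?I b" u 0] by simp
    ultimately show ?thesis using ab I by blast
  qed
qed

text \<open>The minimal count at a scale lies between 0 and \<open>nat R\<close>, so it cannot drop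
  strictly at \<open>nat R + 1\<close> consecutive steps. The chosen \<open>y\<close> attains the
  minimum just before a step without a drop.\<close>

lemma stable_scale:
  assumes X: "X \<noteq> {}"
  obtains j y where "j \<le> nat R" "y \<in> X"
    "\<And>z. z \<in> X \<Longrightarrow> card (crossing T x (W j) y m) \<le> card (crossing T x (W (Suc j)) z m)"
proof -
  define c where "c j = (LEAST n. \<exists>y\<in>X. n = card (crossing T x (W j) y m))" for j
  have ex: "\<exists>y\<in>X. c j = card (crossing T x (W j) y m)" for j
  proof -
    obtain y where "y \<in> X" using X by blast
    then have "\<exists>n. \<exists>y\<in>X. n = card (crossing T x (W j) y m)" by blast
    then show ?thesis unfolding c_def by (rule LeastI_ex)
  qed
  have le: "c j \<le> card (crossing T x (W j) z m)" if "z \<in> X" for j z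
    unfolding c_def by (rule Least_le) (use that in blast)
  have "\<exists>j\<le>nat R. c j \<le> c (Suc j)"
  proof (rule ccontr)
    assume "\<not> ?thesis"
    then have less: "c (Suc j) < c j" if "j \<le> nat R" for j using that by auto
    have "c j + j \<le> c 0" if "j \<le> Suc (nat R)" for j
      using that
    proof (induction j)
      case (Suc j)
      then show ?case using less[of j] by simp
    qed simp
    from this[of "Suc (nat R)"] have "nat R < c 0" by simp
    then show False using ex[of 0] card_crossing_le by (metis not_less)
  qed
  then obtain j where "j \<le> nat R" "c j \<le> c (Suc j)" by blast
  moreover obtain y where "y \<in> X" "c j = card (crossing T x (W j) y m)" using ex by blast
  ultimately show ?thesis using that[of j y] le order_trans by metis
qed

text \<open>If the orbit avoided \<open>w\<close>, then at a stable scale one thread through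
  \<open>y\<close> would be good and another not, while the dense orbit of \<open>d\<close> joins
  the two. The bound \<open>T\<close> is affine in \<open>N\<close>.\<close>

lemma bounded_hitting_time:
  fixes L N :: int
  assumes d: "dense_orbit d" and L: "0 \<le> L"
    and rec: "\<And>x y M s. x \<in> X \<Longrightarrow> y \<in> X \<Longrightarrow> 1 \<le> M \<Longrightarrow>
      \<exists>k. 1 \<le> k \<and> k \<le> L * M + 1 \<and> occurs M y (s + k) x"
    and x: "x \<in> X" and w: "w \<in> X" and N: "2 * R < N"
    and T: "T = (L + 1) * ((4 * R + (L + 1) * N) * (L + 2) ^ Suc (nat R)) + 1"
  shows "\<exists>k\<ge>1. (adv x ^^ k) 0 \<le> T \<and> occurs N w ((adv x ^^ k) 0 - R) x"
proof (rule ccontr)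
  assume "\<not> ?thesis"
  then have avoid: "\<not> occurs N w ((adv x ^^ k) 0 - R) x" if "1 \<le> k" "(adv x ^^ k) 0 \<le> T" for k
    using that by blast
  have R: "0 < R" by (rule R_pos[OF x])
  \<comment> \<open>\<open>M0\<close> leaves room for an occurrence of \<open>w\<close> beyond the
    margin; the ratio \<open>L + 2\<close> makes \<open>W (Suc j) - W j\<close> at least the return
    bound \<open>L * W j + 1\<close>.\<close>
  define M0 where "M0 = 4 * R + (L + 1) * N"
  define W where "W j = M0 * (L + 2) ^ j" for j :: nat
  have LN: "0 \<le> (L + 1) * N" using L N R by simp
  then have M0: "0 < M0" using R unfolding M0_def by linarith
  obtain j y where j: "j \<le> nat R" and y: "y \<in> X"
    and card: "\<And>z. z \<in> X \<Longrightarrow>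
      card (crossing T x (W j) y (2 * R)) \<le> card (crossing T x (W (Suc j)) z (2 * R))"
    using stable_scale[of T x W "2 * R"] x by blast
  have "1 \<le> (L + 2) ^ j" using L by (intro one_le_power) simp
  then have W0: "M0 \<le> W j" using M0 by (simp add: W_def)
  have WS: "W (Suc j) = W j * (L + 2)" by (simp add: W_def algebra_simps)
  have "(L + 2) ^ j \<le> (L + 2) ^ Suc (nat R)" using L j by (intro power_increasing) auto
  then have "(L + 1) * W j \<le> (L + 1) * (M0 * (L + 2) ^ Suc (nat R))"
    using L M0 unfolding W_def by (intro mult_left_mono) auto
  then have WT: "(L + 1) * W j + 1 \<le> T" by (simp add: T M0_def)
  have W3: "3 * R \<le> W j" "1 \<le> W j" using W0 R LN unfolding M0_def by linarith+
  obtain i where i: "1 \<le> i" "i \<le> L * W j + 1" "occurs (W j) y i x"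
    using rec[OF x y W3(2), of 0] by auto
  have "i + W j \<le> T" using i(2) WT by (simp add: algebra_simps)
  then obtain t where t: "t \<in> crossing T x (W j) y (2 * R)"
    using crossing_nonempty[OF x y _ _ i(3) W3(1)] i(1) by fastforce
  have "1 \<le> N" using N R by simp
  \<comment> \<open>Searching from \<open>R - 1\<close> places the occurrence of \<open>w\<close> at
    distance at least \<open>R\<close> from the start of the window.\<close>
  then obtain k where k: "1 \<le> k" "k \<le> L * N + 1" "occurs N w (R - 1 + k) y"
    using rec[OF y w] by blast
  have "R - 1 + k + N \<le> R + (L + 1) * N" using k(2) by (simp add: algebra_simps)
  also have "\<dots> < W j" using W0 R by (simp add: M0_def)
  finally have "R - 1 + k + N < W j" .
  then obtain t' where t': "t' \<notin> crossing T x (W j) y (2 * R)" "R \<le> t'" "t' < 2 * R" "2 * R \<le> adv y t'"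
    using crossing_misses_thread[OF x y W3(1) avoid k(3)] k(1) N by (smt (verit))
  \<comment> \<open>One thread of \<open>v\<close> passes \<open>t\<close> in one occurrence and
    \<open>t'\<close> in another; transport then forces both to be good or neither.\<close>
  obtain v u where v: "v \<in> X" "occurs (W j) y (- t) v" "occurs (W j) y (u - t') v" "same_orbit (adv v) 0 u"
    using dense_orbit_links[OF d y] by blast
  have t2: "R \<le> t" "t < 2 * R" "2 * R \<le> adv y t" using t by (auto simp: crossing_def traces_def)
  have "t < W j - R" "t' < W j - R" using t2 t' W3 by linarith+
  then have "adv v (- t + t) = - t + adv y t" "adv v (u - t' + t') = u - t' + adv y t'"
    using adv_occurs[OF v(1) y v(2) t2(1)] adv_occurs[OF v(1) y v(3) t'(2)] by blast+
  then have "0 - (- t) \<in> crossing T x (W j) y (2 * R) \<longleftrightarrow> u - (u - t') \<in> crossing T x (W j) y (2 * R)"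
    using t2 t'
  proof (intro crossing_transport[OF x y v(1) W3(1) card _ v(2,3) _ _ _ _ v(4)])
    fix s
    have "L * W j + 1 \<le> W (Suc j) - W j" using W3(2) unfolding WS by (simp add: algebra_simps)
    then show "\<exists>k. 1 \<le> k \<and> k \<le> W (Suc j) - W j \<and> occurs (W j) y (s + k) v"
      using rec[OF v(1) y W3(2), of s] by force
  qed auto
  then show False using t t' by simp
qed

section \<open>Coded words versus words of \<open>X\<close>\<close>

lemma funpow_adv_le: "x \<in> X \<Longrightarrow> (adv x ^^ k) 0 \<le> int k * R"
proof (induction k)
  case (Suc k)
  then show ?case using adv_le[of x "(adv x ^^ k) 0"] by (simp add: algebra_simps)
qed simp

lemma coding_nat:
  "speedup_coding X p x (int m) = subword x ((adv x ^^ m) 0) (p (shiftz ((adv x ^^ m) 0) x))"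
  by (simp add: speedup_coding_def int_iterate_def funpow_speedup speedup_letter_def subword_def
      shiftz_def add.commute)

lemma coding_shiftz:
  "speedup_coding X p (shiftz ((adv x ^^ k) 0) x) (int m) = speedup_coding X p x (int (k + m))"
proof -
  have "(speedup p ^^ (k + m)) x = (speedup p ^^ m) ((speedup p ^^ k) x)"
    by (metis add.commute funpow_add o_apply)
  then show ?thesis
    by (simp add: speedup_coding_def int_iterate_def funpow_speedup[symmetric] nat_add_distrib)
qed

lemma coding_occurs:
  "occurs (int n) (speedup_coding X p y) (int k) (speedup_coding X p x) \<longleftrightarrow>
     (\<forall>m<n. speedup_coding X p (shiftz ((adv x ^^ k) 0) x) (int m) = speedup_coding X p y (int m))"
proof -
  have "{0..<int n} = int ` {..<n}" by (simp add: image_int_atLeastLessThan lessThan_atLeast0)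
  then show ?thesis by (auto simp: occurs_def coding_shiftz)
qed

text \<open>The first \<open>n\<close> jumps cover at most \<open>n * R\<close> letters; a margin of
  \<open>R\<close> before the origin and \<open>2 * R\<close> after that stretch determines every
  jump on the way.\<close>

lemma coding_eqI:
  assumes xy: "x \<in> X" "y \<in> X" and eq: "occurs (int n * R + 3 * R) (shiftz (- R) y) (- R) x" and m: "m < n"
  shows "speedup_coding X p x (int m) = speedup_coding X p y (int m)"
proof -
  have R: "0 < R" by (rule R_pos[OF xy(1)])
  have adv: "adv x t = adv y t" if "0 \<le> t" "t < int n * R + R" for t
    using adv_occurs[OF xy(1) shiftz_X[OF xy(2)] eq, of "t + R"] that by (simp add: adv_shiftz)
  have pow: "(adv x ^^ k) 0 = (adv y ^^ k) 0" if "k \<le> n" for k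
    using that
  proof (induction k)
    case (Suc k)
    have "int k * R \<le> int n * R" using Suc.prems R by (intro mult_right_mono) auto
    then have "(adv y ^^ k) 0 < int n * R + R" using funpow_adv_le[OF xy(2), of k] R by linarith
    moreover have "0 \<le> (adv y ^^ k) 0" using funpow_ge[OF adv_gt[OF xy(2)], of 0 k] by simp
    ultimately show ?case using Suc adv by simp
  qed simp
  define a where "a = (adv y ^^ m) 0"
  have "(int m + 1) * R \<le> int n * R" using m R by (intro mult_right_mono) auto
  then have a: "0 \<le> a" "a + R \<le> int n * R"
    using funpow_ge[OF adv_gt[OF xy(2)], of 0 m] funpow_adv_le[OF xy(2), of m]
    by (auto simp: a_def algebra_simps)
  have "p (shiftz a x) = p (shiftz a y)" using adv[of a] a R by (simp add: adv_def)
  moreover have "x (a + int i) = y (a + int i)" if "i < p (shiftz a y)" for i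
  proof -
    have "int i < R" using that p_le[OF shiftz_X[OF xy(2)], of a] by simp
    then show ?thesis using eq a R
      by (auto simp: occurs_def shiftz_def dest!: bspec[of _ _ "a + int i + R"])
  qed
  ultimately show ?thesis
    using pow[of m] m by (simp add: coding_nat a_def[symmetric] subword_eq_iff)
qed

text \<open>Equal letters have equal lengths, so both orbits advance in step; as no block is empty,
  the concatenation covers at least \<open>n\<close> positions.\<close>

lemma occurs_if_coding_eq:
  assumes xy: "x \<in> X" "y \<in> X"
    and eq: "\<And>m. m < n \<Longrightarrow> speedup_coding X p x (int m) = speedup_coding X p y (int m)"
  shows "occurs (int n) y 0 x"
proof -
  have "(adv x ^^ k) 0 = (adv y ^^ k) 0 \<and> occurs ((adv y ^^ k) 0) y 0 x" if "k \<le> n" for k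
    using that
  proof (induction k)
    case (Suc k)
    define a where "a = (adv y ^^ k) 0"
    have IH: "(adv x ^^ k) 0 = a" "occurs a y 0 x" using Suc by (auto simp: a_def)
    have sub: "subword x a (p (shiftz a x)) = subword y a (p (shiftz a y))"
      using eq[of k] Suc.prems IH(1) by (simp add: coding_nat a_def[symmetric])
    from arg_cong[OF this, of length] have p: "p (shiftz a x) = p (shiftz a y)"
      by (simp add: subword_def)
    have *: "x (a + int i) = y (a + int i)" if "i < p (shiftz a y)" for i
      using sub that unfolding p subword_eq_iff by blast
    have "x j = y j" if "a \<le> j" "j < adv y a" for j
      using *[of "nat (j - a)"] that by (simp add: adv_def)
    then have "occurs (adv y a) y 0 x" using IH(2) by (auto simp: occurs_def not_less[symmetric])
    moreover have "adv x a = adv y a" using p by (simp add: adv_def)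
    ultimately show ?case using IH(1) by (simp add: a_def[symmetric])
  qed (simp add: occurs_def)
  from this[of n] have "occurs ((adv y ^^ n) 0) y 0 x" by simp
  moreover have "int n \<le> (adv y ^^ n) 0" using funpow_ge[OF adv_gt[OF xy(2)], of 0 n] by simp
  ultimately show ?thesis by (auto simp: occurs_def)
qed

lemma linearly_recurrent_coding_iff:
  assumes d: "dense_orbit d" and coding: "shift ` speedup_subshift X p = speedup_subshift X p"
  shows "linearly_recurrent X \<longleftrightarrow> linearly_recurrent (speedup_subshift X p)"
proof -
  let ?cod = "speedup_coding X p"
  have d_X: "d \<in> X" using d by (simp add: dense_orbit_def)
  have R: "0 < R" by (rule R_pos[OF d_X])
  have "linearly_recurrent X \<longleftrightarrow>
      (\<exists>L::nat. \<forall>y\<in>X. \<forall>x\<in>X. \<forall>n\<ge>1. \<exists>k\<le>L * n. occurs (int n) y (int k + 1) x)"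
    by (rule linearly_recurrent_iff[OF shiftz_X])
  also have "\<dots> \<longleftrightarrow>
      (\<exists>L::nat. \<forall>y\<in>X. \<forall>x\<in>X. \<forall>n\<ge>1. \<exists>k\<le>L * n. occurs (int n) (?cod y) (int k + 1) (?cod x))"
  proof
    assume "\<exists>L::nat. \<forall>y\<in>X. \<forall>x\<in>X. \<forall>n\<ge>1. \<exists>k\<le>L * n. occurs (int n) y (int k + 1) x"
    then obtain L :: nat where
      L: "\<exists>k\<le>L * n. occurs (int n) y (int k + 1) x" if "x \<in> X" "y \<in> X" "1 \<le> n" for x y n
      by blast
    have rec: "\<exists>k. 1 \<le> k \<and> k \<le> int L * M + 1 \<and> occurs M y (s + k) x"
      if xy: "x \<in> X" "y \<in> X" "1 \<le> M" for x y M s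
    proof -
      have "1 \<le> nat M" using xy(3) by simp
      then obtain k where k: "k \<le> L * nat M" "occurs (int (nat M)) y (int k + 1) (shiftz s x)"
        using L[OF shiftz_X[OF xy(1)] xy(2)] by blast
      have "int k \<le> int (L * nat M)" using k(1) by (simp only: of_nat_le_iff)
      then show ?thesis using k(2) xy(3)
        by (intro exI[of _ "int k + 1"]) (simp add: occurs_shiftz add.commute add.left_commute)
    qed
    \<comment> \<open>Chosen so that \<open>N \<le> 4 * R * n\<close> turns the hitting bound into
      \<open>(K - 1) * n + 1\<close>.\<close>
    define K where "K = (int L + 1) * (4 * R * (int L + 2) * (int L + 2) ^ Suc (nat R)) + 1"
    have K: "0 \<le> K" using R by (simp add: K_def)
    have "\<exists>k\<le>nat K * n. occurs (int n) (?cod y) (int k + 1) (?cod x)"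
      if xy: "x \<in> X" "y \<in> X" and n: "1 \<le> n" for x y n
    proof -
      define N where "N = int n * R + 3 * R"
      define T where "T = (int L + 1) * ((4 * R + (int L + 1) * N) * (int L + 2) ^ Suc (nat R)) + 1"
      have nR: "R \<le> int n * R" using n R by simp
      then have N: "2 * R < N" using R unfolding N_def by linarith
      obtain k where k: "1 \<le> k" "(adv x ^^ k) 0 \<le> T" "occurs N (shiftz (- R) y) ((adv x ^^ k) 0 - R) x"
        using bounded_hitting_time[OF d _ rec xy(1) shiftz_X[OF xy(2)] N T_def] by auto
      have "N \<le> 4 * R * int n" using nR by (simp add: N_def algebra_simps)
      then have "(int L + 1) * N \<le> (int L + 1) * (4 * R * int n)" by (intro mult_left_mono) auto
      then have "4 * R + (int L + 1) * N \<le> 4 * R * (int L + 2) * int n"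
        using nR by (simp add: algebra_simps)
      then have "T \<le> (int L + 1) * (4 * R * (int L + 2) * int n * (int L + 2) ^ Suc (nat R)) + 1"
        unfolding T_def by (intro add_mono mult_left_mono mult_right_mono) auto
      also have "\<dots> = (K - 1) * int n + 1" by (simp add: K_def)
      also have "\<dots> \<le> K * int n" using n by (simp add: algebra_simps)
      \<comment> \<open>Every jump is at least 1, so the number of jumps is at most the position
        reached.\<close>
      finally have "int k \<le> K * int n"
        using k(2) funpow_ge[OF adv_gt[OF xy(1)], of 0 k] by simp
      also have "\<dots> = int (nat K * n)" using K by simp
      finally have "k - 1 \<le> nat K * n" by linarith
      moreover have "occurs N (shiftz (- R) y) (- R) (shiftz ((adv x ^^ k) 0) x)"
        using k(3) by (simp add: occurs_shiftz)
      then have "occurs (int n) (?cod y) (int k) (?cod x)"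
        unfolding coding_occurs N_def using coding_eqI[OF shiftz_X[OF xy(1)] xy(2)] by blast
      then have "occurs (int n) (?cod y) (int (k - 1) + 1) (?cod x)" using k(1) by simp
      ultimately show ?thesis by blast
    qed
    then show "\<exists>L::nat. \<forall>y\<in>X. \<forall>x\<in>X. \<forall>n\<ge>1. \<exists>k\<le>L * n. occurs (int n) (?cod y) (int k + 1) (?cod x)"
      by blast
  next
    assume "\<exists>L::nat. \<forall>y\<in>X. \<forall>x\<in>X. \<forall>n\<ge>1. \<exists>k\<le>L * n. occurs (int n) (?cod y) (int k + 1) (?cod x)"
    then obtain L :: nat where
      L: "\<exists>k\<le>L * n. occurs (int n) (?cod y) (int k + 1) (?cod x)" if "x \<in> X" "y \<in> X" "1 \<le> n" for x y n
      by blast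
    \<comment> \<open>Each coded letter spans at most \<open>R\<close> positions;
      \<open>L + 1\<close> in place of \<open>L\<close> absorbs the one extra jump, since
      \<open>n \<ge> 1\<close>.\<close>
    have "\<exists>k\<le>(L + 1) * nat R * n. occurs (int n) y (int k + 1) x"
      if xy: "x \<in> X" "y \<in> X" and n: "1 \<le> n" for x y n
    proof -
      obtain k where k: "k \<le> L * n" "occurs (int n) (?cod y) (int (Suc k)) (?cod x)"
        using L[OF xy n] by (auto simp: add.commute)
      define a where "a = (adv x ^^ Suc k) 0"
      have "occurs (int n) y 0 (shiftz a x)"
        unfolding a_def using k(2)[unfolded coding_occurs]
        by (intro occurs_if_coding_eq[OF shiftz_X[OF xy(1)] xy(2)]) blast
      then have occ: "occurs (int n) y a x" by (simp add: occurs_shiftz)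
      have a: "1 \<le> a" using funpow_ge[OF adv_gt[OF xy(1)], of 0 "Suc k"] by (simp add: a_def)
      have "Suc k \<le> (L + 1) * n" using k(1) n by simp
      then have "int (Suc k) * R \<le> int ((L + 1) * n) * R"
        using R by (intro mult_right_mono) (simp_all only: of_nat_le_iff less_imp_le)
      also have "\<dots> = int ((L + 1) * nat R * n)" using R by (simp add: algebra_simps)
      finally have "a \<le> int ((L + 1) * nat R * n)"
        using funpow_adv_le[OF xy(1), of "Suc k"] by (simp only: a_def)
      then have "nat (a - 1) \<le> (L + 1) * nat R * n" by linarith
      then show ?thesis using occ a by (intro exI[of _ "nat (a - 1)"]) simp
    qed
    then show "\<exists>L::nat. \<forall>y\<in>X. \<forall>x\<in>X. \<forall>n\<ge>1. \<exists>k\<le>L * n. occurs (int n) y (int k + 1) x"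
      by blast
  qed
  also have "\<dots> \<longleftrightarrow> linearly_recurrent (speedup_subshift X p)"
    using linearly_recurrent_iff[of "speedup_subshift X p"] shiftz_mem[OF coding]
    by (simp add: speedup_subshift_def)
  finally show ?thesis .
qed

end

section \<open>Compactness\<close>

lemma openin_cylinder:
  assumes X: "subshift A X" and J: "finite J"
  shows "openin (subshift_topology A X) {x \<in> X. \<forall>j\<in>J. x j = y j}"
proof -
  let ?T = "subshift_topology A X"
  have top: "topspace ?T = X" by (rule topspace_subshift_topology[OF X])
  have coord: "continuous_map ?T (discrete_topology A) (\<lambda>x. x j)" for j
    unfolding full_shift_topology_def
    by (intro continuous_map_from_subtopology continuous_map_product_projection) auto
  have in_A: "x j \<in> A" if "x \<in> X" for x j
    using continuous_map_image_subset_topspace[OF coord] top that by force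
  \<comment> \<open>The values of \<open>y\<close> may lie outside \<open>A\<close>; intersecting
    with \<open>A\<close> gives an open set of the discrete space.\<close>
  have "openin ?T {x \<in> topspace ?T. x j \<in> {y j} \<inter> A}" for j
    by (rule openin_continuous_map_preimage[OF coord]) simp
  then have "openin ?T ((\<Inter>j\<in>J. {x \<in> topspace ?T. x j \<in> {y j} \<inter> A}) \<inter> topspace ?T)"
    by (intro openin_INT[OF J])
  also have "(\<Inter>j\<in>J. {x \<in> topspace ?T. x j \<in> {y j} \<inter> A}) \<inter> topspace ?T = {x \<in> X. \<forall>j\<in>J. x j = y j}"
    unfolding top using in_A by auto
  finally show ?thesis .
qed

text \<open>A basic open set of the product restricts only finitely many coordinates, all inside
  some central window.\<close>

lemma openin_subshift_nbhd:
  assumes X: "subshift A X" and U: "openin (subshift_topology A X) U" "x \<in> U"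
  obtains n :: nat where "{z \<in> X. \<forall>j\<in>{- int n..int n}. z j = x j} \<subseteq> U"
proof -
  obtain V where V: "openin (full_shift_topology A) V" "U = V \<inter> X"
    using U(1) by (auto simp: openin_subtopology)
  have sub: "X \<subseteq> topspace (full_shift_topology A)"
    using X closedin_subset by (auto simp: subshift_def)
  obtain F where F: "finite {i. F i \<noteq> A}" "x \<in> Pi\<^sub>E UNIV F" "Pi\<^sub>E UNIV F \<subseteq> V"
    using V U(2) unfolding full_shift_topology_def openin_product_topology_alt by auto
  define n where "n = Max (insert 0 ((\<lambda>i. nat \<bar>i\<bar>) ` {i. F i \<noteq> A}))"
  have n: "i \<in> {- int n..int n}" if "F i \<noteq> A" for i
  proof -
    have "nat \<bar>i\<bar> \<le> n" unfolding n_def using F(1) that by (intro Max_ge) auto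
    then show ?thesis by auto
  qed
  have "z \<in> U" if z: "z \<in> X" "\<forall>j\<in>{- int n..int n}. z j = x j" for z
  proof -
    have "z i \<in> F i" for i
    proof (cases "F i = A")
      case True
      then show ?thesis using z(1) sub by (auto simp: full_shift_topology_def)
    next
      case False
      then have "z i = x i" using n z(2) by blast
      then show ?thesis using F(2) by (auto simp: PiE_iff)
    qed
    then have "z \<in> Pi\<^sub>E UNIV F" by auto
    then show ?thesis using F(3) V(2) z(1) by blast
  qed
  then show ?thesis using that by blast
qed

text \<open>The sets \<open>G n\<close> of points at which the central window of radius
  \<open>n\<close> determines \<open>p\<close> are open, increase with \<open>n\<close> and cover
  \<open>X\<close>; by compactness one of them is all of \<open>X\<close>.\<close>

lemma locally_constant_uniform:
  assumes X: "subshift A X"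
    and p: "continuous_map (subshift_topology A X) (discrete_topology B) p"
  obtains n :: nat where
    "\<And>x y. x \<in> X \<Longrightarrow> y \<in> X \<Longrightarrow> (\<And>j. j \<in> {- int n..int n} \<Longrightarrow> x j = y j) \<Longrightarrow> p x = p y"
proof -
  let ?T = "subshift_topology A X"
  have top: "topspace ?T = X" by (rule topspace_subshift_topology[OF X])
  define C where "C n x = {z \<in> X. \<forall>j\<in>{- int n..int n}. z j = x j}" for n x
  define G where "G n = {x \<in> X. \<forall>y\<in>C n x. p y = p x}" for n
  have mono: "G m \<subseteq> G n" if "m \<le> n" for m n
  proof -
    have "{- int m..int m} \<subseteq> {- int n..int n}" using that by auto
    then have "C n x \<subseteq> C m x" for x unfolding C_def by blast
    then show ?thesis unfolding G_def by blast
  qed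
  have "openin ?T (G n)" for n
  proof (subst openin_subopen, intro ballI)
    fix x assume x: "x \<in> G n"
    have "C n z = C n x" "z \<in> X" if "z \<in> C n x" for z using that by (auto simp: C_def)
    then have "C n x \<subseteq> G n" using x by (auto simp: G_def)
    moreover have "openin ?T (C n x)" unfolding C_def by (rule openin_cylinder[OF X]) simp
    ultimately show "\<exists>U. openin ?T U \<and> x \<in> U \<and> U \<subseteq> G n"
      using x by (intro exI[of _ "C n x"]) (auto simp: G_def C_def)
  qed
  moreover have "X \<subseteq> \<Union> (range G)"
  proof
    fix x assume x: "x \<in> X"
    have "p x \<in> B" using continuous_map_image_subset_topspace[OF p] top x by auto
    then have "openin ?T {z \<in> topspace ?T. p z \<in> {p x}}"
      by (intro openin_continuous_map_preimage[OF p]) simp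
    moreover have "x \<in> {z \<in> topspace ?T. p z \<in> {p x}}" unfolding top using x by simp
    ultimately obtain n where "C n x \<subseteq> {z \<in> topspace ?T. p z \<in> {p x}}"
      using openin_subshift_nbhd[OF X] unfolding C_def by blast
    then show "x \<in> \<Union> (range G)" using x by (auto simp: G_def)
  qed
  moreover have "\<exists>H. finite H \<and> H \<subseteq> range G \<and> X \<subseteq> \<Union> H"
    if "\<forall>U\<in>range G. openin ?T U" "X \<subseteq> \<Union> (range G)"
    using compact_space_subshift[OF X] that unfolding compact_space_alt top by blast
  ultimately obtain H where H: "finite H" "H \<subseteq> range G" "X \<subseteq> \<Union> H"
    by blast
  then obtain I where I: "finite I" "H = G ` I" using finite_subset_image[OF H(1,2)] by auto
  define n where "n = Max (insert 0 I)"
  have "X \<subseteq> G n"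
  proof
    fix x assume "x \<in> X"
    then obtain i where "i \<in> I" "x \<in> G i" using H I by auto
    then show "x \<in> G n" using mono[of i n] I by (auto simp: n_def)
  qed
  then have "p x = p y" if "x \<in> X" "y \<in> X" "\<And>j. j \<in> {- int n..int n} \<Longrightarrow> x j = y j" for x y
  proof -
    have "y \<in> C n x" using that by (simp add: C_def)
    then show ?thesis using that(1) \<open>X \<subseteq> G n\<close> by (auto simp: G_def)
  qed
  then show ?thesis by (rule that)
qed

lemma bounded_speedupI:
  assumes X: "subshift A X"
    and p: "continuous_map (subshift_topology A X) (discrete_topology {1..}) p"
    and S: "homeomorphic_map (subshift_topology A X) (subshift_topology A X) (speedup p)"
  obtains R where "bounded_speedup X p R"
proof -
  let ?T = "subshift_topology A X"
  have top: "topspace ?T = X" by (rule topspace_subshift_topology[OF X])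
  have "compactin (discrete_topology {1..}) (p ` X)"
    using image_compactin[OF _ p] compact_space_subshift[OF X] top by (metis compact_space_def)
  then have pX: "p ` X \<subseteq> {1..}" "finite (p ` X)" by (auto simp: compactin_discrete_topology)
  obtain n :: nat where
    n: "\<And>x y. x \<in> X \<Longrightarrow> y \<in> X \<Longrightarrow> (\<And>j. j \<in> {- int n..int n} \<Longrightarrow> x j = y j) \<Longrightarrow> p x = p y"
    using locally_constant_uniform[OF X p] by blast
  \<comment> \<open>Enlarging a radius keeps \<open>p\<close> determined, so the maximum serves both
    purposes.\<close>
  define R where "R = max (int n) (int (Max (p ` X)))"
  have "bounded_speedup X p R"
  proof
    show "shift ` X = X" using X by (simp add: subshift_def)
    show "0 < p x" if "x \<in> X" for x using pX(1) that by force
    show "int (p x) \<le> R" if "x \<in> X" for x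
      using Max_ge[OF pX(2), of "p x"] that by (simp add: R_def)
    show "p x = p y" if "x \<in> X" "y \<in> X" "\<And>j. j \<in> {- R..R} \<Longrightarrow> x j = y j" for x y
      by (rule n[OF that(1,2)], rule that(3)) (auto simp: R_def)
    show "bij_betw (speedup p) X X"
      using S top by (simp add: homeomorphic_eq_everything_map bij_betw_def)
  qed
  then show ?thesis by (rule that)
qed

theorem theorem1p1:
  fixes A :: "'a set" and X :: "(int \<Rightarrow> 'a) set" and p :: "(int \<Rightarrow> 'a) \<Rightarrow> nat"
  assumes "subshift A X"
    and "cantor_space (subshift_topology A X)"
    and "continuous_map (subshift_topology A X) (discrete_topology {1..}) p"
    and "homeomorphic_map (subshift_topology A X) (subshift_topology A X) (speedup p)"
    and "transitive_homeo (subshift_topology A X) (speedup p)"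
  shows "linearly_recurrent X \<longleftrightarrow> linearly_recurrent (speedup_subshift X p)"
proof -
  note X = assms(1)
  let ?T = "subshift_topology A X"
  have top: "topspace ?T = X" by (rule topspace_subshift_topology[OF X])
  obtain R where "bounded_speedup X p R" using bounded_speedupI[OF assms(1,3,4)] .
  then interpret bounded_speedup X p R .
  obtain x where x: "x \<in> X"
    and dense: "?T closure_of (range (\<lambda>n. int_iterate X (speedup p) n x)) = X"
    using assms(5) unfolding transitive_homeo_def top by blast
  have "\<exists>a. occurs M y t (int_iterate X (speedup p) a x)" if y: "y \<in> X" for y M t
  proof -
    \<comment> \<open>The cylinder of the word of \<open>y\<close> placed at position
      \<open>t\<close>, a neighbourhood of \<open>shiftz (- t) y\<close>.\<close>
    let ?U = "{z \<in> X. \<forall>j\<in>{t..<t + M}. z j = shiftz (- t) y j}"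
    have "openin ?T ?U" by (rule openin_cylinder[OF X]) simp
    moreover have "shiftz (- t) y \<in> ?U" using shiftz_X[OF y] by simp
    moreover have "shiftz (- t) y \<in> ?T closure_of (range (\<lambda>n. int_iterate X (speedup p) n x))"
      unfolding dense by (rule shiftz_X[OF y])
    ultimately have "\<exists>z\<in>range (\<lambda>n. int_iterate X (speedup p) n x). z \<in> ?U"
      unfolding in_closure_of by (metis (no_types, lifting))
    then obtain a where a: "int_iterate X (speedup p) a x \<in> ?U" by blast
    then have "occurs M y t (int_iterate X (speedup p) a x)"
      by (auto simp: occurs_def shiftz_def)
    then show ?thesis ..
  qed
  then have "dense_orbit x" using x by (simp add: dense_orbit_def)
  moreover have "shift ` speedup_subshift X p = speedup_subshift X p"
    using subshift_speedup[OF assms(1,3,4)] by (simp add: subshift_def)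
  ultimately show ?thesis by (rule linearly_recurrent_coding_iff)
qed

end
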